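(* Let $\Sigma$ be a compact connected oriented surface of genus $g\geq 1$ whose intersection form on $H=H_1(\Sigma,\mathbb{Z})$ is non-degenerate, and let $\mathbb{Q}H$ be the homological Goldman Lie algebra of $\Sigma$. Then the quotient Lie algebra $\mathbb{Q}H/\mathbb{Q}[0]$ is generated as a Lie algebra by (the classes of $[s]$ for) $2g+1$ primitive elements $s$ of $H$, and $2g+1$ is the minimal number of generators of $\mathbb{Q}H/\mathbb{Q}[0]$ consisting of elements of $H$; that is, if $S\subset H$ is such that the images of $\{[s]\mid s\in S\}$ generate $\mathbb{Q}H/\mathbb{Q}[0]$ as a Lie algebra, then $\#S\geq 2g+1$.
   Context: The intersection form is the skew-symmetric bilinear form $\langle -,-\rangle: H\times H\to\mathbb{Z}$ on $H=H_1(\Sigma,\mathbb{Z})$. It is non-degenerate exactly when $\Sigma$ is closed or has one boundary component; in that case $H$ is a free $\mathbb{Z}$-module of rank $2g$ admitting a symplectic basis, i.e. a $\mathbb{Z}$-basis $\{A_i,B_i\}_{i=1}^g$ with $\langle A_i,B_j\rangle=\delta_{ij}$ and $\langle A_i,A_j\rangle=\langle B_i,B_j\rangle=0$ for all $i,j$. $\mathbb{Q}H$ denotes the $\mathbb{Q}$-vector space with basis the set $H$; the basis element corresponding to $x\in H$ is written $[x]$ (so $[0]$ is a nonzero basis vector). The homological Goldman Lie algebra of $\Sigma$ is $\mathbb{Q}H$ equipped with the Lie bracket that is the bilinear extension of $[[x],[y]]:=\langle x,y\rangle[x+y]$ for $x,y\in H$. The line $\mathbb{Q}[0]$ spanned by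 $[0]$ is an ideal (it is central). An element of $H$ is primitive if it is nonzero and not of the form $nx$ with $x\in H$ and $n\geq 2$ an integer. A subset generates a Lie algebra if the smallest Lie subalgebra (over $\mathbb{Q}$) containing it is the whole Lie algebra. *)

theory Defs
  imports Complex_Main "HOL-Library.Poly_Mapping"
begin

section \<open>Lie algebras\<close>

locale lie_algebra = vector_space scale
  for scale :: "'k::field \<Rightarrow> 'a::ab_group_add \<Rightarrow> 'a" +
  fixes bracket :: "'a \<Rightarrow> 'a \<Rightarrow> 'a"
  assumes bracket_add_left: "bracket (u + v) w = bracket u w + bracket v w"
    and bracket_add_right: "bracket u (v + w) = bracket u v + bracket u w"
    and bracket_scale_left: "bracket (scale c u) v = scale c (bracket u v)"
    and bracket_scale_right: "bracket u (scale c v) = scale c (bracket u v)"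
    and bracket_self: "bracket u u = 0"
    and jacobi: "bracket u (bracket v w) + bracket v (bracket w u) + bracket w (bracket u v) = 0"

definition lie_subalgebra ::
    "('k::field \<Rightarrow> 'a::ab_group_add \<Rightarrow> 'a) \<Rightarrow> ('a \<Rightarrow> 'a \<Rightarrow> 'a) \<Rightarrow> 'a set \<Rightarrow> bool" where
  "lie_subalgebra scale bracket L \<longleftrightarrow>
     module.subspace scale L \<and> (\<forall>u\<in>L. \<forall>v\<in>L. bracket u v \<in> L)"

definition lie_generates ::
    "('k::field \<Rightarrow> 'a::ab_group_add \<Rightarrow> 'a) \<Rightarrow> ('a \<Rightarrow> 'a \<Rightarrow> 'a) \<Rightarrow> 'a set \<Rightarrow> bool" where
  "lie_generates scale bracket S \<longleftrightarrow> lie_subalgebra scale bracket hull S = UNIV"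


section \<open>Abelian groups as modules over the integers\<close>

definition zscale :: "int \<Rightarrow> 'h::ab_group_add \<Rightarrow> 'h" where
  "zscale n x = (if 0 \<le> n then ((+) x ^^ nat n) 0 else - ((+) x ^^ nat (- n)) 0)"

definition primitive :: "'h::ab_group_add \<Rightarrow> bool" where
  "primitive x \<longleftrightarrow> x \<noteq> 0 \<and> \<not> (\<exists>n y. 2 \<le> n \<and> x = zscale n y)"

lemma zscale_of_nat: "zscale (int n) x = ((+) x ^^ n) 0"
  by (simp add: zscale_def)

lemma zscale_0 [simp]: "zscale 0 x = 0"
  by (simp add: zscale_def)

lemma zscale_Suc: "zscale (int (Suc n)) x = x + zscale (int n) x"
  by (simp only: zscale_of_nat funpow.simps o_apply)

lemma zscale_minus: "zscale (- n) x = - zscale n x"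
  by (cases "n = 0") (auto simp: zscale_def)

lemma zscale_add_one: "zscale (n + 1) x = x + zscale n x"
proof (cases "0 \<le> n")
  case True
  then obtain m where "n = int m" using nonneg_int_cases by blast
  then show ?thesis using zscale_Suc[of m x] by (simp add: add.commute)
next
  case False
  then obtain m where m: "n = - int (Suc m)"
    by (metis int_cases linorder_not_less nat_int_comparison(1) negD)
  then have "n + 1 = - int m" by simp
  then show ?thesis using zscale_Suc[of m x] m by (simp only: zscale_minus) simp
qed

lemma zscale_one [simp]: "zscale 1 x = x"
  using zscale_add_one[of 0 x] by simp

lemma zscale_add_left: "zscale (m + n) x = zscale m x + zscale n x"
proof (induction m rule: int_induct[where k = 0])
  case base
  then show ?case by simp
next
  case (step1 i)
  have "zscale (i + 1 + n) x = zscale ((i + n) + 1) x" by (simp add: ac_simps)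
  then show ?case using step1 by (simp only: zscale_add_one) (simp add: ac_simps)
next
  case (step2 i)
  have "zscale (i + n) x = x + zscale (i - 1 + n) x"
    using zscale_add_one[of "i - 1 + n" x] by simp
  moreover have "zscale i x = x + zscale (i - 1) x"
    using zscale_add_one[of "i - 1" x] by simp
  ultimately show ?case using step2 by (simp add: add.assoc)
qed

lemma zscale_add_right: "zscale n (x + y) = zscale n x + zscale n y"
proof (induction n rule: int_induct[where k = 0])
  case base
  then show ?case by simp
next
  case (step1 i)
  then show ?case by (simp only: zscale_add_one) (simp add: ac_simps)
next
  case (step2 i)
  then show ?case
    using zscale_add_one[of "i - 1" x] zscale_add_one[of "i - 1" y]
      zscale_add_one[of "i - 1" "x + y"] by (simp add: algebra_simps)
qed

lemma zscale_zscale: "zscale m (zscale n x) = zscale (m * n) x"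
proof (induction m rule: int_induct[where k = 0])
  case base
  then show ?case by simp
next
  case (step1 i)
  then show ?case by (simp add: zscale_add_one distrib_right zscale_add_left add.commute)
next
  case (step2 i)
  have "zscale (i * n) x = zscale n x + zscale ((i - 1) * n) x"
    using zscale_add_left[of n "(i - 1) * n" x] by (simp add: algebra_simps)
  then show ?case using step2 zscale_add_one[of "i - 1" "zscale n x"] by simp
qed

lemma module_zscale: "module (zscale :: int \<Rightarrow> 'h::ab_group_add \<Rightarrow> 'h)"
  by standard (auto simp: zscale_add_left zscale_add_right zscale_zscale)


section \<open>Intersection forms\<close>

definition symplectic_basis ::
    "nat \<Rightarrow> ('h::ab_group_add \<Rightarrow> 'h \<Rightarrow> int) \<Rightarrow> (nat \<Rightarrow> 'h) \<Rightarrow> (nat \<Rightarrow> 'h) \<Rightarrow> bool" where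
  "symplectic_basis g \<omega> A B \<longleftrightarrow>
     \<not> module.dependent zscale (A ` {..<g} \<union> B ` {..<g}) \<and>
     module.span zscale (A ` {..<g} \<union> B ` {..<g}) = UNIV \<and>
     (\<forall>i<g. \<forall>j<g. \<omega> (A i) (B j) = (if i = j then 1 else 0) \<and>
                  \<omega> (A i) (A j) = 0 \<and> \<omega> (B i) (B j) = 0)"

text \<open>
  A compact connected oriented surface of genus \<open>g\<close> with non-degenerate intersection form enters
  only through its first integral homology, the group \<open>'h\<close>, and the intersection form \<open>\<omega>\<close> on it.
  The pairs \<open>('h, \<omega>)\<close> arising in this way are, up to isomorphism, exactly those of this locale.
\<close>

locale surface_intersection_form =
  fixes g :: nat and \<omega> :: "'h::ab_group_add \<Rightarrow> 'h \<Rightarrow> int"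
  assumes form_add_left: "\<omega> (x + y) z = \<omega> x z + \<omega> y z"
    and form_add_right: "\<omega> x (y + z) = \<omega> x y + \<omega> x z"
    and form_skew: "\<omega> x y = - \<omega> y x"
    and form_nondegenerate: "(\<And>y. \<omega> x y = 0) \<Longrightarrow> x = 0"
    and form_symplectic_basis: "\<exists>A B. symplectic_basis g \<omega> A B"


section \<open>The homological Goldman Lie algebra\<close>

text \<open>The rational vector space with basis \<open>'h\<close>; the basis vector of \<open>x\<close> is \<open>single x 1\<close>.\<close>

type_synonym 'h QH = "'h \<Rightarrow>\<^sub>0 rat"

definition qh_scale :: "rat \<Rightarrow> 'h QH \<Rightarrow> 'h QH" where
  "qh_scale c u = Poly_Mapping.map ((*) c) u"

definition qh_basis :: "'h \<Rightarrow> 'h QH" where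
  "qh_basis x = Poly_Mapping.single x 1"

definition goldman_bracket ::
    "('h::ab_group_add \<Rightarrow> 'h \<Rightarrow> int) \<Rightarrow> 'h QH \<Rightarrow> 'h QH \<Rightarrow> 'h QH" where
  "goldman_bracket \<omega> u v =
     (\<Sum>x\<in>Poly_Mapping.keys u. \<Sum>y\<in>Poly_Mapping.keys v.
        qh_scale (Poly_Mapping.lookup u x * Poly_Mapping.lookup v y * of_int (\<omega> x y))
          (qh_basis (x + y)))"

lemma lookup_qh_scale [simp]: "Poly_Mapping.lookup (qh_scale c u) x = c * Poly_Mapping.lookup u x"
  by (simp add: qh_scale_def Poly_Mapping.map.rep_eq when_def)

lemma lookup_qh_basis: "Poly_Mapping.lookup (qh_basis x) y = (if x = y then 1 else 0)"
  by (simp add: qh_basis_def lookup_single when_def)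

lemma qh_scale_basis: "qh_scale c (qh_basis x) = Poly_Mapping.single x c"
  by (rule poly_mapping_eqI) (simp add: qh_basis_def lookup_single when_def)

lemma vector_space_qh_scale: "vector_space qh_scale"
  by standard (auto intro!: poly_mapping_eqI simp: lookup_add algebra_simps)

interpretation qh: vector_space qh_scale
  by (rule vector_space_qh_scale)

lemma goldman_bracket_eq_sum:
  assumes "finite X" "Poly_Mapping.keys u \<subseteq> X" "finite Y" "Poly_Mapping.keys v \<subseteq> Y"
  shows "goldman_bracket \<omega> u v =
     (\<Sum>x\<in>X. \<Sum>y\<in>Y.
        qh_scale (Poly_Mapping.lookup u x * Poly_Mapping.lookup v y * of_int (\<omega> x y))
          (qh_basis (x + y)))"
proof -
  have "(\<Sum>y\<in>Poly_Mapping.keys v.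
        qh_scale (Poly_Mapping.lookup u x * Poly_Mapping.lookup v y * of_int (\<omega> x y))
          (qh_basis (x + y))) =
      (\<Sum>y\<in>Y. qh_scale (Poly_Mapping.lookup u x * Poly_Mapping.lookup v y * of_int (\<omega> x y))
          (qh_basis (x + y)))" for x
    using assms by (intro sum.mono_neutral_left) (auto simp: in_keys_iff)
  then show ?thesis
    unfolding goldman_bracket_def
    using assms by (simp, intro sum.mono_neutral_left) (auto simp: in_keys_iff)
qed

lemma goldman_bracket_basis:
  "goldman_bracket \<omega> (qh_basis x) (qh_basis y) = qh_scale (of_int (\<omega> x y)) (qh_basis (x + y))"
  by (simp add: goldman_bracket_def qh_basis_def)

lemma goldman_bracket_add_left:
  "goldman_bracket \<omega> (u + v) w = goldman_bracket \<omega> u w + goldman_bracket \<omega> v w"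
proof -
  let ?X = "Poly_Mapping.keys u \<union> Poly_Mapping.keys v" and ?Y = "Poly_Mapping.keys w"
  have "Poly_Mapping.keys (u + v) \<subseteq> ?X" by (rule keys_add)
  then show ?thesis
    by (simp add: goldman_bracket_eq_sum[where X = ?X and Y = ?Y] lookup_add distrib_right
        qh.scale_left_distrib sum.distrib)
qed

lemma goldman_bracket_add_right:
  "goldman_bracket \<omega> w (u + v) = goldman_bracket \<omega> w u + goldman_bracket \<omega> w v"
proof -
  let ?Y = "Poly_Mapping.keys u \<union> Poly_Mapping.keys v" and ?X = "Poly_Mapping.keys w"
  have "Poly_Mapping.keys (u + v) \<subseteq> ?Y" by (rule keys_add)
  then show ?thesis
    by (simp add: goldman_bracket_eq_sum[where X = ?X and Y = ?Y] lookup_add algebra_simps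
        qh.scale_left_distrib sum.distrib)
qed

lemma keys_qh_scale: "Poly_Mapping.keys (qh_scale c u) \<subseteq> Poly_Mapping.keys u"
  by (auto simp: in_keys_iff)

lemma goldman_bracket_scale_left:
  "goldman_bracket \<omega> (qh_scale c u) v = qh_scale c (goldman_bracket \<omega> u v)"
  by (simp add: goldman_bracket_eq_sum[where X = "Poly_Mapping.keys u" and Y = "Poly_Mapping.keys v"]
      keys_qh_scale qh.scale_sum_right mult.assoc)

lemma goldman_bracket_scale_right:
  "goldman_bracket \<omega> u (qh_scale c v) = qh_scale c (goldman_bracket \<omega> u v)"
  by (simp add: goldman_bracket_eq_sum[where X = "Poly_Mapping.keys u" and Y = "Poly_Mapping.keys v"]
      keys_qh_scale qh.scale_sum_right mult.assoc mult.left_commute)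

lemma qh_induct [case_names zero add]:
  assumes "P 0" and "\<And>u c x. P u \<Longrightarrow> P (u + qh_scale c (qh_basis x))"
  shows "P u"
proof -
  have "P (\<Sum>x\<in>X. qh_scale (Poly_Mapping.lookup u x) (qh_basis x))" if "finite X" for X
    using that
  proof induction
    case empty
    then show ?case by (simp add: assms(1))
  next
    case (insert x F)
    then show ?case
      using assms(2)[of "\<Sum>x\<in>F. qh_scale (Poly_Mapping.lookup u x) (qh_basis x)"]
      by (simp add: add.commute)
  qed
  moreover have "(\<Sum>x\<in>Poly_Mapping.keys u. qh_scale (Poly_Mapping.lookup u x) (qh_basis x)) = u"
    by (rule poly_mapping_eqI)
      (simp add: lookup_sum lookup_qh_basis in_keys_iff if_distrib sum.delta' cong: if_cong)
  ultimately show ?thesis by (metis finite_keys)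
qed

context surface_intersection_form
begin

lemma form_zero [simp]: "\<omega> 0 x = 0" "\<omega> x 0 = 0"
  using form_add_left[of 0 0 x] form_add_right[of x 0 0] by simp_all

lemma form_self [simp]: "\<omega> x x = 0"
  using form_skew[of x x] by simp

lemma goldman_bracket_zero [simp]:
  "goldman_bracket \<omega> 0 u = 0" "goldman_bracket \<omega> u 0 = 0"
  by (simp_all add: goldman_bracket_def)

lemma goldman_bracket_skew: "goldman_bracket \<omega> u v = - goldman_bracket \<omega> v u"
proof -
  have "goldman_bracket \<omega> u v = (\<Sum>y\<in>Poly_Mapping.keys v. \<Sum>x\<in>Poly_Mapping.keys u.
        - qh_scale (Poly_Mapping.lookup v y * Poly_Mapping.lookup u x * of_int (\<omega> y x))
          (qh_basis (y + x)))"
    unfolding goldman_bracket_def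
    by (subst sum.swap, intro sum.cong refl, subst form_skew) (simp add: ac_simps)
  then show ?thesis
    by (simp add: goldman_bracket_def sum_negf)
qed

lemma goldman_bracket_self: "goldman_bracket \<omega> u u = 0"
proof -
  have "Poly_Mapping.lookup (goldman_bracket \<omega> u u) x =
      - Poly_Mapping.lookup (goldman_bracket \<omega> u u) x" for x
    using goldman_bracket_skew[of u u] by (metis lookup_uminus uminus_apply)
  then show ?thesis by (intro poly_mapping_eqI) simp
qed

sublocale goldman: lie_algebra qh_scale "goldman_bracket \<omega>"
proof unfold_locales
  note bilin = goldman_bracket_add_left goldman_bracket_add_right
    goldman_bracket_scale_left goldman_bracket_scale_right
  fix u v w
  show "goldman_bracket \<omega> u (goldman_bracket \<omega> v w) + goldman_bracket \<omega> v (goldman_bracket \<omega> w u) +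
      goldman_bracket \<omega> w (goldman_bracket \<omega> u v) = 0"
  proof (induction u rule: qh_induct)
    case zero
    then show ?case by simp
  next
    case (add u a x)
    have "goldman_bracket \<omega> (qh_basis x) (goldman_bracket \<omega> v w) +
      goldman_bracket \<omega> v (goldman_bracket \<omega> w (qh_basis x)) +
      goldman_bracket \<omega> w (goldman_bracket \<omega> (qh_basis x) v) = 0"
    proof (induction v rule: qh_induct)
      case zero
      then show ?case by simp
    next
      case (add v b y)
      have "goldman_bracket \<omega> (qh_basis x) (goldman_bracket \<omega> (qh_basis y) w) +
        goldman_bracket \<omega> (qh_basis y) (goldman_bracket \<omega> w (qh_basis x)) +
        goldman_bracket \<omega> w (goldman_bracket \<omega> (qh_basis x) (qh_basis y)) = 0"
      proof (induction w rule: qh_induct)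
        case zero
        then show ?case by simp
      next
        case (add w c z)
        have "(of_int (\<omega> y z * \<omega> x (y + z) + \<omega> z x * \<omega> y (z + x) + \<omega> x y * \<omega> z (x + y)) :: rat) = 0"
          by (simp add: form_add_right form_skew[of y x] form_skew[of z x] form_skew[of z y]
              algebra_simps)
        then have "goldman_bracket \<omega> (qh_basis x) (goldman_bracket \<omega> (qh_basis y) (qh_basis z)) +
          goldman_bracket \<omega> (qh_basis y) (goldman_bracket \<omega> (qh_basis z) (qh_basis x)) +
          goldman_bracket \<omega> (qh_basis z) (goldman_bracket \<omega> (qh_basis x) (qh_basis y)) = 0"
          by (simp add: bilin goldman_bracket_basis ac_simps flip: qh.scale_left_distrib)
        then have "qh_scale c (goldman_bracket \<omega> (qh_basis x) (goldman_bracket \<omega> (qh_basis y) (qh_basis z)) +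
          goldman_bracket \<omega> (qh_basis y) (goldman_bracket \<omega> (qh_basis z) (qh_basis x)) +
          goldman_bracket \<omega> (qh_basis z) (goldman_bracket \<omega> (qh_basis x) (qh_basis y))) = 0"
          by simp
        with add show ?case by (simp add: bilin qh.scale_right_distrib algebra_simps)
      qed
      then have "qh_scale b (goldman_bracket \<omega> (qh_basis x) (goldman_bracket \<omega> (qh_basis y) w) +
        goldman_bracket \<omega> (qh_basis y) (goldman_bracket \<omega> w (qh_basis x)) +
        goldman_bracket \<omega> w (goldman_bracket \<omega> (qh_basis x) (qh_basis y))) = 0" by simp
      with add show ?case by (simp add: bilin qh.scale_right_distrib algebra_simps)
    qed
    then have "qh_scale a (goldman_bracket \<omega> (qh_basis x) (goldman_bracket \<omega> v w) +
      goldman_bracket \<omega> v (goldman_bracket \<omega> w (qh_basis x)) +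
      goldman_bracket \<omega> w (goldman_bracket \<omega> (qh_basis x) v)) = 0" by simp
    with add show ?case by (simp add: bilin qh.scale_right_distrib algebra_simps)
  qed
qed (simp_all add: goldman_bracket_add_left goldman_bracket_add_right
    goldman_bracket_scale_left goldman_bracket_scale_right goldman_bracket_self)

lemma goldman_bracket_central: "goldman_bracket \<omega> (qh_scale c (qh_basis 0)) u = 0"
  "goldman_bracket \<omega> u (qh_scale c (qh_basis 0)) = 0"
  by (induction u rule: qh_induct)
    (simp_all add: goldman_bracket_add_left goldman_bracket_add_right
      goldman_bracket_scale_left goldman_bracket_scale_right goldman_bracket_basis)

end


section \<open>The quotient by the central line spanned by \<open>[0]\<close>\<close>

definition qh_congruent :: "'h::ab_group_add QH \<Rightarrow> 'h QH \<Rightarrow> bool" where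
  "qh_congruent u v \<longleftrightarrow> u - v \<in> qh.span {qh_basis 0}"

quotient_type (overloaded) 'h QH0 = "'h::ab_group_add QH" / qh_congruent
proof (rule equivpI)
  show "reflp qh_congruent"
    by (simp add: reflp_def qh_congruent_def qh.span_zero)
  show "symp qh_congruent"
    unfolding symp_def qh_congruent_def using qh.span_neg by fastforce
  show "transp qh_congruent"
    unfolding transp_def qh_congruent_def using qh.span_add by fastforce
qed

instantiation QH0 :: (ab_group_add) ab_group_add
begin

lift_definition zero_QH0 :: "'a QH0" is 0 .

lift_definition plus_QH0 :: "'a QH0 \<Rightarrow> 'a QH0 \<Rightarrow> 'a QH0" is "(+)"
  unfolding qh_congruent_def by (simp add: add_diff_add qh.span_add)

lift_definition uminus_QH0 :: "'a QH0 \<Rightarrow> 'a QH0" is uminus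
  unfolding qh_congruent_def minus_diff_minus by (rule qh.span_neg)

lift_definition minus_QH0 :: "'a QH0 \<Rightarrow> 'a QH0 \<Rightarrow> 'a QH0" is "(-)"
proof -
  fix u u' v v' :: "'a QH"
  assume "qh_congruent u u'" "qh_congruent v v'"
  then have "(u - u') - (v - v') \<in> qh.span {qh_basis 0}"
    unfolding qh_congruent_def by (rule qh.span_diff)
  then show "qh_congruent (u - v) (u' - v')"
    by (simp add: qh_congruent_def algebra_simps)
qed

instance
  by standard (transfer; simp add: qh_congruent_def qh.span_zero algebra_simps)+

end

lift_definition QH0_scale :: "rat \<Rightarrow> 'h::ab_group_add QH0 \<Rightarrow> 'h QH0" is qh_scale
  unfolding qh_congruent_def by (simp add: qh.span_scale flip: qh.scale_right_diff_distrib)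

definition QH0_class :: "'h::ab_group_add QH \<Rightarrow> 'h QH0" where
  "QH0_class u = abs_QH0 u"

text \<open>
  The bracket of two classes is the class of the bracket of representatives. The choice of
  representatives does not matter when \<open>\<omega>\<close> is bilinear (lemma \<open>QH0_bracket_class\<close> below).
\<close>

definition QH0_bracket ::
    "('h::ab_group_add \<Rightarrow> 'h \<Rightarrow> int) \<Rightarrow> 'h QH0 \<Rightarrow> 'h QH0 \<Rightarrow> 'h QH0" where
  "QH0_bracket \<omega> U V = QH0_class (goldman_bracket \<omega> (rep_QH0 U) (rep_QH0 V))"

lemma QH0_class_eq_iff: "QH0_class u = QH0_class v \<longleftrightarrow> u - v \<in> qh.span {qh_basis 0}"
  by (simp add: QH0_class_def QH0.abs_eq_iff qh_congruent_def)

lemma QH0_class_add: "QH0_class (u + v) = QH0_class u + QH0_class v"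
  by (simp add: QH0_class_def plus_QH0.abs_eq)

lemma QH0_class_scale: "QH0_class (qh_scale c u) = QH0_scale c (QH0_class u)"
  by (simp add: QH0_class_def QH0_scale.abs_eq)

lemma QH0_class_zero: "QH0_class 0 = 0"
  by (simp add: QH0_class_def zero_QH0_def)

lemma QH0_class_rep: "QH0_class (rep_QH0 U) = U"
  by (simp add: QH0_class_def Quotient3_abs_rep[OF Quotient3_QH0])

lemma QH0_class_cases: obtains u where "U = QH0_class u"
  by (metis QH0_class_rep)

context surface_intersection_form
begin

lemma QH0_bracket_class:
  "QH0_bracket \<omega> (QH0_class u) (QH0_class v) = QH0_class (goldman_bracket \<omega> u v)"
proof -
  have rep: "\<exists>c. rep_QH0 (QH0_class w) = w + qh_scale c (qh_basis 0)" for w :: "'h QH"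
  proof -
    have "rep_QH0 (QH0_class w) - w \<in> qh.span {qh_basis 0}"
      using QH0_class_rep QH0_class_eq_iff by blast
    then obtain c where "rep_QH0 (QH0_class w) - w = qh_scale c (qh_basis 0)"
      by (auto simp: qh.span_singleton)
    then show ?thesis by (metis add.commute diff_add_cancel)
  qed
  obtain a b where "rep_QH0 (QH0_class u) = u + qh_scale a (qh_basis 0)"
    and "rep_QH0 (QH0_class v) = v + qh_scale b (qh_basis 0)"
    using rep by blast
  then show ?thesis
    by (simp add: QH0_bracket_def goldman_bracket_add_left goldman_bracket_add_right
        goldman_bracket_central)
qed

sublocale goldman_quotient: lie_algebra QH0_scale "QH0_bracket \<omega>"
proof unfold_locales
  fix a b :: rat and U V W :: "'h QH0"
  obtain u v w where [simp]: "U = QH0_class u" "V = QH0_class v" "W = QH0_class w"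
    by (meson QH0_class_cases)
  show "QH0_scale a (U + V) = QH0_scale a U + QH0_scale a V"
    by (simp add: qh.scale_right_distrib flip: QH0_class_add QH0_class_scale)
  show "QH0_scale (a + b) U = QH0_scale a U + QH0_scale b U"
    by (simp add: qh.scale_left_distrib flip: QH0_class_add QH0_class_scale)
  show "QH0_scale a (QH0_scale b U) = QH0_scale (a * b) U"
    by (simp flip: QH0_class_scale)
  show "QH0_scale 1 U = U"
    by (simp flip: QH0_class_scale)
  show "QH0_bracket \<omega> (U + V) W = QH0_bracket \<omega> U W + QH0_bracket \<omega> V W"
    by (simp add: QH0_bracket_class goldman.bracket_add_left flip: QH0_class_add)
  show "QH0_bracket \<omega> U (V + W) = QH0_bracket \<omega> U V + QH0_bracket \<omega> U W"
    by (simp add: QH0_bracket_class goldman.bracket_add_right flip: QH0_class_add)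
  show "QH0_bracket \<omega> (QH0_scale a U) V = QH0_scale a (QH0_bracket \<omega> U V)"
    by (simp add: QH0_bracket_class goldman.bracket_scale_left flip: QH0_class_scale)
  show "QH0_bracket \<omega> U (QH0_scale a V) = QH0_scale a (QH0_bracket \<omega> U V)"
    by (simp add: QH0_bracket_class goldman.bracket_scale_right flip: QH0_class_scale)
  show "QH0_bracket \<omega> U U = 0"
    by (simp add: QH0_bracket_class goldman.bracket_self QH0_class_zero)
  show "QH0_bracket \<omega> U (QH0_bracket \<omega> V W) + QH0_bracket \<omega> V (QH0_bracket \<omega> W U) +
      QH0_bracket \<omega> W (QH0_bracket \<omega> U V) = 0"
    by (simp add: QH0_bracket_class goldman.jacobi flip: QH0_class_add)
      (simp add: QH0_class_zero)
qed

end

end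

theory Submission
  imports Defs
begin

text \<open>
  Since the Lie algebra is graded by \<open>H\<close> with one-dimensional pieces, a subalgebra generated by
  classes of elements of \<open>H\<close> is governed by the set \<open>T\<close> of those \<open>x\<close> whose class it contains, and
  \<open>x + y \<in> T\<close> whenever \<open>x, y \<in> T\<close> and \<open>\<omega> x y \<noteq> 0\<close>.

  Generation: \<open>H\<close> has a basis \<open>e\<^sub>0, \<dots>, e\<^bsub>2g-1\<^esub>\<close> with \<open>\<omega> e\<^sub>i e\<^sub>j = 1\<close> for all \<open>i < j\<close>; the
  remaining generator is \<open>- \<Sum> e\<^sub>i\<close>. Adding to it the basis elements at the two ends of the interval of
  indices that is left, one never meets a zero pairing and reaches every \<open>- e\<^sub>i\<close>. To add
  \<open>u = \<plusminus>e\<^sub>i\<close> to an \<open>x \<in> T\<close> with \<open>\<omega> x u = 0\<close>, one writes \<open>x + u = (x + v) + (u - v)\<close> for some \<open>v\<close>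
  that is orthogonal to none of \<open>x\<close>, \<open>x + u\<close>, \<open>u\<close>.

  Minimality: if \<open>S\<close> generates, then every element of \<open>H\<close>, in particular \<open>- \<Sum> S\<close>, is a
  combination of \<open>S\<close> with natural coefficients. So \<open>S\<close> spans the rational vector space
  \<open>\<rat> \<otimes> H\<close> and satisfies a relation with positive coefficients, whence \<open>#S > 2 g\<close>.
\<close>

section \<open>Supports of vectors of the rational space\<close>

lemma keys_of_span_qh_basis:
  assumes "u \<in> qh.span (qh_basis ` X)"
  shows "Poly_Mapping.keys u \<subseteq> X"
  using assms
proof (induction rule: qh.span_induct_alt)
  case base
  then show ?case by simp
next
  case (step c x y)
  have "Poly_Mapping.keys (qh_scale c x + y) \<subseteq> Poly_Mapping.keys x \<union> Poly_Mapping.keys y"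
    using keys_add[of "qh_scale c x" y] keys_qh_scale[of c x] by blast
  then show ?case using step by (auto simp: qh_basis_def)
qed

lemma inj_qh_basis: "inj qh_basis"
  by (rule injI) (metis lookup_qh_basis zero_neq_one)

lemma independent_qh_basis: "qh.independent (qh_basis ` X)"
proof
  assume "qh.dependent (qh_basis ` X)"
  then obtain x where "x \<in> X" "qh_basis x \<in> qh.span (qh_basis ` X - {qh_basis x})"
    by (auto simp: qh.dependent_def)
  moreover have "qh_basis ` X - {qh_basis x} = qh_basis ` (X - {x})"
    using inj_qh_basis by (auto simp: inj_def)
  ultimately have "Poly_Mapping.keys (qh_basis x) \<subseteq> X - {x}"
    using keys_of_span_qh_basis by metis
  then show False by (simp add: qh_basis_def)
qed

lemma QH0_class_qh_basis_zero: "QH0_class (qh_basis 0) = 0"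
  by (metis QH0_class_eq_iff QH0_class_zero diff_zero insertI1 qh.span_base)

section \<open>The form, and subalgebras of the quotient\<close>

context surface_intersection_form
begin

lemma form_minus [simp]: "\<omega> (- x) y = - \<omega> x y" "\<omega> x (- y) = - \<omega> x y"
  using form_add_left[of x "- x" y] form_add_right[of x y "- y"] by simp_all

lemma form_diff: "\<omega> (x - z) y = \<omega> x y - \<omega> z y" "\<omega> x (y - z) = \<omega> x y - \<omega> x z"
  using form_add_left[of x "- z" y] form_add_right[of x y "- z"] by simp_all

lemma form_sum: "\<omega> (sum f I) y = (\<Sum>i\<in>I. \<omega> (f i) y)" "\<omega> y (sum f I) = (\<Sum>i\<in>I. \<omega> y (f i))"
  by (induction I rule: infinite_finite_induct) (simp_all add: form_add_left form_add_right)

lemma form_zscale: "\<omega> (zscale n x) y = n * \<omega> x y"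
  by (induction n rule: int_induct[where k = 0])
    (simp_all add: zscale_add_left form_add_left form_diff distrib_right left_diff_distrib
      zscale_add_left[of _ "-1", simplified] zscale_minus)

text \<open>If \<open>x = zscale n z\<close>, then \<open>n\<close> divides every pairing with
  \<open>x\<close>. The instance \<open>n = 2\<close> also rules out \<open>x = 0\<close>.\<close>

lemma primitiveI:
  assumes "\<And>n. 2 \<le> n \<Longrightarrow> \<exists>y. \<not> n dvd \<omega> x y"
  shows "primitive x"
  unfolding primitive_def using assms[of 2] assms by (fastforce simp: form_zscale)

lemma subgroup_eq_UNIV:
  assumes "symplectic_basis g \<omega> A B"
    and "0 \<in> X" "\<And>x y. x \<in> X \<Longrightarrow> y \<in> X \<Longrightarrow> x + y \<in> X" "\<And>x. x \<in> X \<Longrightarrow> - x \<in> X"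
    and "\<And>i. i < g \<Longrightarrow> A i \<in> X" "\<And>i. i < g \<Longrightarrow> B i \<in> X"
  shows "X = UNIV"
proof -
  interpret Z: module "zscale :: int \<Rightarrow> 'h \<Rightarrow> 'h" by (rule module_zscale)
  have "zscale (int n) x \<in> X" if "x \<in> X" for n x
    using that assms(2,3) by (induction n) (simp_all only: zscale_Suc, simp)
  then have "zscale n x \<in> X" if "x \<in> X" for n x
    using that assms(4) by (cases n rule: int_cases2) (simp_all add: zscale_minus)
  then have "Z.subspace X" using assms(2,3) by (simp add: Z.subspace_def)
  moreover have "A ` {..<g} \<union> B ` {..<g} \<subseteq> X" using assms(5,6) by auto
  ultimately have "Z.span (A ` {..<g} \<union> B ` {..<g}) \<subseteq> X" by (intro Z.span_minimal)
  then show ?thesis using assms(1) by (simp add: symplectic_basis_def top.extremum_unique)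
qed

lemma lie_generates_iff:
  "lie_generates QH0_scale (QH0_bracket \<omega>) X \<longleftrightarrow>
    (\<forall>L. lie_subalgebra QH0_scale (QH0_bracket \<omega>) L \<longrightarrow> X \<subseteq> L \<longrightarrow> L = UNIV)"
  unfolding lie_generates_def hull_def by blast

text \<open>The class of \<open>[0]\<close> vanishes in the quotient, and the bracket of the classes
  of \<open>[x]\<close> and \<open>[y]\<close> is \<omega> x y times that of \<open>[x + y]\<close>,
  a factor that is invertible over the rationals unless it is zero.\<close>

lemma lie_subalgebra_homogeneous:
  assumes "lie_subalgebra QH0_scale (QH0_bracket \<omega>) L"
  defines "T \<equiv> {x. QH0_class (qh_basis x) \<in> L}"
  shows "0 \<in> T" and "\<lbrakk>x \<in> T; y \<in> T; \<omega> x y \<noteq> 0\<rbrakk> \<Longrightarrow> x + y \<in> T" and "T = UNIV \<Longrightarrow> L = UNIV"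
proof -
  have sub: "goldman_quotient.subspace L"
    and br: "\<And>U V. U \<in> L \<Longrightarrow> V \<in> L \<Longrightarrow> QH0_bracket \<omega> U V \<in> L"
    using assms(1) by (auto simp: lie_subalgebra_def)
  show "0 \<in> T"
    using goldman_quotient.subspace_0[OF sub] by (simp add: T_def QH0_class_qh_basis_zero)
  show "x + y \<in> T" if "x \<in> T" "y \<in> T" "\<omega> x y \<noteq> 0"
  proof -
    have "QH0_scale (of_int (\<omega> x y)) (QH0_class (qh_basis (x + y))) \<in> L"
      using br[of "QH0_class (qh_basis x)" "QH0_class (qh_basis y)"] that
      by (simp add: T_def QH0_bracket_class goldman_bracket_basis QH0_class_scale)
    then have "QH0_scale (1 / of_int (\<omega> x y))
        (QH0_scale (of_int (\<omega> x y)) (QH0_class (qh_basis (x + y)))) \<in> L"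
      by (rule goldman_quotient.subspace_scale[OF sub])
    then show ?thesis using that by (simp add: T_def)
  qed
  show "L = UNIV" if "T = UNIV"
  proof -
    have "QH0_class u \<in> L" for u
    proof (induction u rule: qh_induct)
      case zero
      then show ?case using goldman_quotient.subspace_0[OF sub] by (simp add: QH0_class_zero)
    next
      case (add u c x)
      have "QH0_class (qh_basis x) \<in> L" using that by (auto simp: T_def)
      then show ?case
        using add goldman_quotient.subspace_add[OF sub] goldman_quotient.subspace_scale[OF sub]
        by (simp add: QH0_class_add QH0_class_scale)
    qed
    then show ?thesis by (metis QH0_class_cases UNIV_eq_I)
  qed
qed

section \<open>The lower bound on the number of generators\<close>

text \<open>Brackets only add indices, so the classes of vectors supported in a submonoid
  \<open>C\<close> form a Lie subalgebra.\<close>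

lemma submonoid_eq_UNIV_if_generates:
  assumes gen: "lie_generates QH0_scale (QH0_bracket \<omega>) ((\<lambda>s. QH0_class (qh_basis s)) ` S)"
    and C: "S \<subseteq> C" "0 \<in> C" "\<And>x y. x \<in> C \<Longrightarrow> y \<in> C \<Longrightarrow> x + y \<in> C"
  shows "C = UNIV"
proof -
  define L where "L = QH0_class ` qh.span (qh_basis ` C)"
  have basis: "qh_basis x \<in> qh.span (qh_basis ` C)" if "x \<in> C" for x
    using that by (simp add: qh.span_base)
  have "goldman_quotient.subspace L"
    unfolding goldman_quotient.subspace_def
  proof (intro conjI ballI allI)
    show "0 \<in> L"
      unfolding L_def by (metis QH0_class_zero imageI qh.span_zero)
    show "U + V \<in> L" if "U \<in> L" "V \<in> L" for U V
      using that unfolding L_def by (auto simp flip: QH0_class_add intro: qh.span_add)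
    show "QH0_scale c U \<in> L" if "U \<in> L" for c U
      using that unfolding L_def by (auto simp flip: QH0_class_scale intro: qh.span_scale)
  qed
  moreover have "QH0_bracket \<omega> U V \<in> L" if "U \<in> L" "V \<in> L" for U V
  proof -
    obtain u v where uv: "U = QH0_class u" "u \<in> qh.span (qh_basis ` C)"
      "V = QH0_class v" "v \<in> qh.span (qh_basis ` C)"
      using \<open>U \<in> L\<close> \<open>V \<in> L\<close> unfolding L_def by auto
    have "goldman_bracket \<omega> u v \<in> qh.span (qh_basis ` C)"
      unfolding goldman_bracket_def
      using keys_of_span_qh_basis[OF uv(2)] keys_of_span_qh_basis[OF uv(4)]
      by (intro qh.span_sum qh.span_scale basis C(3)) auto
    then show ?thesis by (simp add: L_def uv QH0_bracket_class)
  qed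
  moreover have "(\<lambda>s. QH0_class (qh_basis s)) ` S \<subseteq> L"
    using C(1) basis unfolding L_def by auto
  ultimately have "L = UNIV"
    using gen by (simp add: lie_generates_iff lie_subalgebra_def)
  have "x \<in> C" for x
  proof (cases "x = 0")
    case False
    obtain u where u: "QH0_class (qh_basis x) = QH0_class u" "u \<in> qh.span (qh_basis ` C)"
      using \<open>L = UNIV\<close> unfolding L_def by blast
    \<comment> \<open>Passing to the quotient changes only the coefficient of \<open>[0]\<close>, so
      for nonzero \<open>x\<close> the coefficient of \<open>[x]\<close> can be compared
      upstairs.\<close>
    then obtain c where "qh_basis x - u = qh_scale c (qh_basis 0)"
      by (auto simp: QH0_class_eq_iff qh.span_singleton)
    then have "Poly_Mapping.lookup (qh_basis x - u) x = 0"
      using False by (simp add: lookup_qh_basis)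
    then have "x \<in> Poly_Mapping.keys u"
      by (simp add: lookup_minus lookup_qh_basis in_keys_iff)
    then show ?thesis using keys_of_span_qh_basis[OF u(2)] by blast
  qed (simp add: C(2))
  then show ?thesis by blast
qed

text \<open>\<open>\<phi>\<close> realises the embedding of \<open>H\<close> into \<open>\<rat> \<otimes> H\<close>, with basis indexed by \<open>{..<2 * g}\<close>.\<close>

lemma rational_coordinates:
  obtains \<phi> :: "'h \<Rightarrow> nat QH"
  where "\<And>x y. \<phi> (x + y) = \<phi> x + \<phi> y"
    and "\<And>k. k < 2 * g \<Longrightarrow> qh_basis k \<in> range \<phi>"
proof -
  obtain A B where AB: "symplectic_basis g \<omega> A B" using form_symplectic_basis by blast
  \<comment> \<open>In a symplectic basis the coefficient of \<open>A i\<close> in \<open>x\<close>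
    is \<omega> x (B i), and that of \<open>B i\<close> is -\<omega> x (A i). Even indices carry the
    first kind, odd indices the second.\<close>
  define \<phi> :: "'h \<Rightarrow> nat QH" where "\<phi> x = (\<Sum>i<g. qh_scale (of_int (\<omega> x (B i))) (qh_basis (2 * i)) -
    qh_scale (of_int (\<omega> x (A i))) (qh_basis (2 * i + 1)))" for x
  have \<phi>_add: "\<phi> (x + y) = \<phi> x + \<phi> y" for x y
    by (simp add: \<phi>_def form_add_left qh.scale_left_distrib flip: sum.distrib)
      (simp add: algebra_simps)
  have A: "\<phi> (A j) = qh_basis (2 * j)" if "j < g" for j
  proof -
    have "\<phi> (A j) = (\<Sum>i<g. if i = j then qh_basis (2 * j) else 0)"
      unfolding \<phi>_def using AB that by (intro sum.cong) (auto simp: symplectic_basis_def)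
    then show ?thesis using that by simp
  qed
  have B: "\<phi> (B j) = qh_basis (2 * j + 1)" if "j < g" for j
  proof -
    have "\<phi> (B j) = (\<Sum>i<g. if i = j then qh_basis (2 * j + 1) else 0)"
      unfolding \<phi>_def using AB that
      by (intro sum.cong) (auto simp: symplectic_basis_def form_skew[of "B j" "A _"])
    then show ?thesis using that by simp
  qed
  have "qh_basis k \<in> range \<phi>" if "k < 2 * g" for k
  proof (cases "even k")
    case True
    then show ?thesis using A[of "k div 2"] that by (metis dvd_mult_div_cancel nat_mult_less_cancel1 pos2 rangeI)
  next
    case False
    then have "k div 2 < g" "2 * (k div 2) + 1 = k" using that by auto
    then show ?thesis using B[of "k div 2"] by (metis rangeI)
  qed
  with \<phi>_add that show thesis by blast
qed

lemma card_ge_if_generates: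
  assumes "g \<ge> 1" and "finite S"
    and gen: "lie_generates QH0_scale (QH0_bracket \<omega>) ((\<lambda>s. QH0_class (qh_basis s)) ` S)"
  shows "card S \<ge> 2 * g + 1"
proof -
  obtain \<phi> :: "'h \<Rightarrow> nat QH" where \<phi>_add: "\<And>x y. \<phi> (x + y) = \<phi> x + \<phi> y"
    and \<phi>_basis: "\<And>k. k < 2 * g \<Longrightarrow> qh_basis k \<in> range \<phi>"
    by (rule rational_coordinates) blast
  have \<phi>_0: "\<phi> 0 = 0" using \<phi>_add[of 0 0] by simp
  have \<phi>_minus: "\<phi> (- x) = - \<phi> x" for x
    using \<phi>_add[of x "- x"] \<phi>_0 by (simp add: eq_neg_iff_add_eq_0 add.commute)
  have \<phi>_sum: "\<phi> (\<Sum>X) = (\<Sum>x\<in>X. \<phi> x)" for X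
    by (induction X rule: infinite_finite_induct) (simp_all add: \<phi>_0 \<phi>_add)
  define C where "C = {x. \<exists>c :: 'h \<Rightarrow> nat. \<phi> x = (\<Sum>s\<in>S. qh_scale (of_nat (c s)) (\<phi> s))}"
  have "C = UNIV"
  proof (rule submonoid_eq_UNIV_if_generates[OF gen])
    show "S \<subseteq> C"
    proof
      fix s assume "s \<in> S"
      have "\<phi> s = (\<Sum>t\<in>S. if t = s then \<phi> s else 0)"
        using \<open>s \<in> S\<close> \<open>finite S\<close> by simp
      also have "\<dots> = (\<Sum>t\<in>S. qh_scale (of_nat (if t = s then 1 else 0)) (\<phi> t))"
        by (intro sum.cong) auto
      finally show "s \<in> C"
        unfolding C_def by (intro CollectI exI[of _ "\<lambda>t. if t = s then 1 else 0"])
    qed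
    show "0 \<in> C"
      unfolding C_def by (intro CollectI exI[of _ "\<lambda>_. 0"]) (simp add: \<phi>_0)
    fix x y assume "x \<in> C" "y \<in> C"
    then obtain a b where "\<phi> x = (\<Sum>s\<in>S. qh_scale (of_nat (a s)) (\<phi> s))"
      "\<phi> y = (\<Sum>s\<in>S. qh_scale (of_nat (b s)) (\<phi> s))"
      unfolding C_def by auto
    then have "\<phi> (x + y) = (\<Sum>s\<in>S. qh_scale (of_nat (a s + b s)) (\<phi> s))"
      by (simp add: \<phi>_add qh.scale_left_distrib sum.distrib)
    then show "x + y \<in> C"
      unfolding C_def by (intro CollectI exI[of _ "\<lambda>s. a s + b s"])
  qed
  have span_S: "\<phi> x \<in> qh.span (\<phi> ` S)" for x
  proof -
    have "x \<in> C" using \<open>C = UNIV\<close> by simp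
    then obtain c where "\<phi> x = (\<Sum>s\<in>S. qh_scale (of_nat (c s)) (\<phi> s))"
      unfolding C_def by auto
    then show ?thesis by (simp add: qh.span_base qh.span_scale qh.span_sum)
  qed
  have "S \<noteq> {}"
  proof
    assume "S = {}"
    then have "\<phi> x = 0" for x using span_S[of x] by simp
    then have "qh_basis 0 = (0 :: nat QH)" using \<phi>_basis[of 0] \<open>g \<ge> 1\<close> by auto
    then show False by (metis lookup_qh_basis lookup_zero zero_neq_one)
  qed
  then obtain s0 where "s0 \<in> S" by blast
  \<comment> \<open>Natural coefficients for the negative of the sum turn into a relation whose
    coefficients \<open>1 + c s\<close> are all positive, so it can be solved for
    \<open>s0\<close>.\<close>
  have "- (\<Sum>S) \<in> C" using \<open>C = UNIV\<close> by simp
  then obtain c where "\<phi> (- (\<Sum>S)) = (\<Sum>s\<in>S. qh_scale (of_nat (c s)) (\<phi> s))"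
    unfolding C_def by auto
  then have "(\<Sum>s\<in>S. \<phi> s) + (\<Sum>s\<in>S. qh_scale (of_nat (c s)) (\<phi> s)) = 0"
    by (simp add: \<phi>_minus \<phi>_sum flip: neg_eq_iff_add_eq_0)
  then have rel: "(\<Sum>s\<in>S. qh_scale (1 + of_nat (c s)) (\<phi> s)) = 0"
    by (simp add: qh.scale_left_distrib sum.distrib)
  let ?R = "qh.span (\<phi> ` (S - {s0}))"
  have "qh_scale (1 + of_nat (c s0)) (\<phi> s0) =
      - (\<Sum>s\<in>S - {s0}. qh_scale (1 + of_nat (c s)) (\<phi> s))"
    using rel \<open>s0 \<in> S\<close> \<open>finite S\<close> by (simp add: sum.remove eq_neg_iff_add_eq_0)
  also have "\<dots> \<in> ?R"
    by (intro qh.span_neg qh.span_sum qh.span_scale) (auto intro: qh.span_base)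
  finally have "qh_scale (1 / (1 + of_nat (c s0))) (qh_scale (1 + of_nat (c s0)) (\<phi> s0)) \<in> ?R"
    by (rule qh.span_scale)
  moreover have "(1 + of_nat (c s0) :: rat) \<noteq> 0"
    by (metis of_nat_Suc of_nat_neq_0)
  ultimately have "\<phi> s0 \<in> ?R" by simp
  moreover have "\<phi> ` S = insert (\<phi> s0) (\<phi> ` (S - {s0}))" using \<open>s0 \<in> S\<close> by blast
  ultimately have "qh.span (\<phi> ` S) = ?R" by (simp add: qh.span_redundant)
  then have "qh_basis ` {..<2 * g} \<subseteq> ?R"
    using \<phi>_basis span_S by fastforce
  then have "card (qh_basis ` {..<2 * g} :: nat QH set) \<le> card (\<phi> ` (S - {s0}))"
    using qh.independent_span_bound[OF _ independent_qh_basis, of "\<phi> ` (S - {s0})"] \<open>finite S\<close>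
    by simp
  also have "\<dots> \<le> card (S - {s0})" using \<open>finite S\<close> by (simp add: card_image_le)
  also have "card (S - {s0}) < card S"
    using \<open>finite S\<close> \<open>s0 \<in> S\<close> by (rule card_Diff1_less)
  also have "card (qh_basis ` {..<2 * g} :: nat QH set) = 2 * g"
    by (simp add: card_image inj_on_subset[OF inj_qh_basis])
  finally show ?thesis by simp
qed

end

section \<open>Generation from a basis with unit pairings\<close>

text \<open>Generation of \<open>H\<close> by the \<open>e i\<close> is stated as an induction
  principle for subgroups, the form in which the later arguments apply it.\<close>

locale unit_intersection_basis = surface_intersection_form g \<omega>
  for g :: nat and \<omega> :: "'h::ab_group_add \<Rightarrow> 'h \<Rightarrow> int" +
  fixes e :: "nat \<Rightarrow> 'h"
  assumes form_e: "\<lbrakk>i < j; j < 2 * g\<rbrakk> \<Longrightarrow> \<omega> (e i) (e j) = 1"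
    and e_generates: "\<lbrakk>0 \<in> X; \<And>x y. x \<in> X \<Longrightarrow> y \<in> X \<Longrightarrow> x + y \<in> X; \<And>x. x \<in> X \<Longrightarrow> - x \<in> X;
      \<And>i. i < 2 * g \<Longrightarrow> e i \<in> X\<rbrakk> \<Longrightarrow> X = UNIV"
begin

lemma form_e_nonzero: "\<lbrakk>i < 2 * g; j < 2 * g; i \<noteq> j\<rbrakk> \<Longrightarrow> \<omega> (e i) (e j) \<noteq> 0"
  using form_e[of i j] form_e[of j i] form_skew[of "e i" "e j"] by (cases i j rule: linorder_cases) auto

text \<open>The elements orthogonal to \<open>x\<close> form a subgroup, which by nondegeneracy is
  proper and so misses some \<open>e i\<close>.\<close>

lemma e_separates:
  assumes "x \<noteq> 0"
  obtains i where "i < 2 * g" "\<omega> x (e i) \<noteq> 0"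
proof -
  have "{y. \<omega> x y = 0} \<noteq> UNIV" using form_nondegenerate assms by auto
  then show thesis
    using e_generates[of "{y. \<omega> x y = 0}"] that by (auto simp: form_add_right)
qed

lemma add_unit_mem:
  assumes T: "0 \<in> T" "\<And>x y. x \<in> T \<Longrightarrow> y \<in> T \<Longrightarrow> \<omega> x y \<noteq> 0 \<Longrightarrow> x + y \<in> T"
    and e: "\<And>i. i < 2 * g \<Longrightarrow> e i \<in> T" "\<And>i. i < 2 * g \<Longrightarrow> - e i \<in> T"
    and "x \<in> T" "i < 2 * g" and u: "u = e i \<or> u = - e i"
  shows "x + u \<in> T"
proof -
  have "u \<in> T" using u e \<open>i < 2 * g\<close> by auto
  consider "\<omega> x u \<noteq> 0" | "x = 0" | "x + u = 0" | "\<omega> x u = 0" "x \<noteq> 0" "x + u \<noteq> 0" by blast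
  then show ?thesis
  proof cases
    case 4
    have via: "x + u \<in> T" if "v \<in> T" "- v \<in> T" "\<omega> x v \<noteq> 0" "\<omega> (x + u) v \<noteq> 0" "\<omega> u v \<noteq> 0" for v
    proof -
      have "x + v \<in> T" using T(2)[of x v] \<open>x \<in> T\<close> that by simp
      moreover have "u + - v \<in> T" using T(2)[of u "- v"] \<open>u \<in> T\<close> that by simp
      moreover have "\<omega> (x + v) (u + - v) = - \<omega> (x + u) v"
        using 4 form_skew[of u v] by (simp add: form_add_left form_add_right del: add_uminus_conv_diff)
      ultimately have "(x + v) + (u + - v) \<in> T" using T(2) that(4) by (metis neg_equal_0_iff_equal)
      then show ?thesis by (simp add: algebra_simps)
    qed
    \<comment> \<open>Since \<open>u\<close> is \<open>e i\<close> up to sign and is orthogonal to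
      \<open>x\<close>, the index \<open>j\<close> differs from \<open>i\<close>.\<close>
    have pair: "\<omega> u (e j) \<noteq> 0" if "j < 2 * g" "\<omega> x (e j) \<noteq> 0" for j
    proof -
      have "i \<noteq> j" using 4(1) u that by auto
      then show ?thesis using form_e_nonzero[of i j] \<open>i < 2 * g\<close> that u by auto
    qed
    obtain n where n: "n < 2 * g" "\<omega> x (e n) \<noteq> 0" using e_separates 4 by blast
    obtain m where m: "m < 2 * g" "\<omega> (x + u) (e m) \<noteq> 0" using e_separates 4 by blast
    show ?thesis
    \<comment> \<open>Unless each of \<open>e n\<close> and \<open>e m\<close> fails for one of
      \<open>x\<close> and \<open>x + u\<close>, one of them already serves as \<open>v\<close>.
      Otherwise a combination of both does.\<close>
    proof (cases "\<omega> (x + u) (e n) = 0 \<and> \<omega> x (e m) = 0")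
      case False
      then show ?thesis using n m via[of "e n"] via[of "e m"] pair e by metis
    next
      case True
      \<comment> \<open>The sign makes \<open>u\<close> pair nontrivially with
        \<open>e n + k\<close>: if the pairing with \<open>e n + e m\<close> is zero, the one with
        \<open>e n - e m\<close> is twice that with \<open>e n\<close>.\<close>
      define k where "k = (if \<omega> u (e n + e m) \<noteq> 0 then e m else - e m)"
      have k: "k \<in> T" "- k \<in> T" "\<omega> x k = 0" "\<omega> (x + u) k \<noteq> 0"
        using m e True by (auto simp: k_def)
      have "n \<noteq> m" using True m by auto
      then have nk: "\<omega> (e n) k \<noteq> 0" using form_e_nonzero n m by (auto simp: k_def)
      show ?thesis
      proof (rule via[of "e n + k"])
        show "e n + k \<in> T" using T(2) e n k nk by auto
        show "- (e n + k) \<in> T" using T(2)[of "- e n" "- k"] e n k nk by (simp add: add.commute)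
        show "\<omega> x (e n + k) \<noteq> 0" using n k by (simp add: form_add_right)
        show "\<omega> (x + u) (e n + k) \<noteq> 0" using True k by (simp add: form_add_right)
        show "\<omega> u (e n + k) \<noteq> 0"
          using pair[OF n] by (auto simp: k_def form_add_right form_diff)
      qed
    qed
  qed (use T \<open>x \<in> T\<close> \<open>u \<in> T\<close> in auto)
qed

text \<open>The interval is trimmed from the top down to \<open>q\<close>, then from the bottom up
  to \<open>p\<close>. All pairings between the removed end and the other indices have the same
  sign, so the total is nonzero while another index is left.\<close>

lemma neg_interval_sum_mem:
  assumes T: "\<And>x y. x \<in> T \<Longrightarrow> y \<in> T \<Longrightarrow> \<omega> x y \<noteq> 0 \<Longrightarrow> x + y \<in> T"
    and e: "\<And>i. i < 2 * g \<Longrightarrow> e i \<in> T" and total: "- sum e {..<2 * g} \<in> T"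
    and "p < q" "q \<le> 2 * g"
  shows "- sum e {p..<q} \<in> T"
proof -
  have upper: "- sum e {0..<q} \<in> T" if "q \<le> 2 * g" "0 < q" for q
    using that
  proof (induction rule: inc_induct)
    case base
    then show ?case using total by (simp add: lessThan_atLeast0)
  next
    case (step n)
    have "(\<Sum>i = 0..<n. \<omega> (e i) (e n)) = int n" using step form_e by simp
    then have "\<omega> (- sum e {0..<Suc n}) (e n) \<noteq> 0" using step by (simp add: form_sum form_diff)
    then have "- sum e {0..<Suc n} + e n \<in> T" using T step.IH step.hyps step.prems e by (metis zero_less_Suc)
    then show ?case by simp
  qed
  have "p < q \<Longrightarrow> ?thesis"
  proof (induction p)
    case 0
    then show ?case using upper \<open>q \<le> 2 * g\<close> by simp
  next
    case (Suc p)
    have "sum e {p..<q} = e p + sum e {Suc p..<q}" using Suc by (simp add: sum.atLeast_Suc_lessThan)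
    moreover have "(\<Sum>i = Suc p..<q. \<omega> (e p) (e i)) = int (q - Suc p)"
      using \<open>q \<le> 2 * g\<close> form_e by simp
    ultimately have "\<omega> (e p) (- sum e {p..<q}) \<noteq> 0" using Suc by (simp add: form_sum form_diff)
    then have "e p + - sum e {p..<q} \<in> T"
      using Suc e \<open>q \<le> 2 * g\<close> by (intro T) simp_all
    then show ?case using \<open>sum e {p..<q} = _\<close> by simp
  qed
  then show ?thesis using \<open>p < q\<close> .
qed

text \<open>In the sum, the \<open>j\<close> smaller indices contribute 1 each and the
  \<open>2 * g - 1 - j\<close> larger ones -1 each. The value is odd, which is what the counting
  below exploits.\<close>

lemma form_total:
  assumes "j < 2 * g"
  shows "\<omega> (- sum e {..<2 * g}) (e j) = 2 * int g - 1 - 2 * int j"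
proof -
  have "\<omega> (sum e {..<2 * g}) (e j) =
      (\<Sum>i<j. \<omega> (e i) (e j)) + (\<Sum>i = Suc j..<2 * g. \<omega> (e i) (e j))"
    using assms sum.atLeastLessThan_concat[of 0 j "2 * g" "\<lambda>i. \<omega> (e i) (e j)"]
      sum.atLeast_Suc_lessThan[of j "2 * g" "\<lambda>i. \<omega> (e i) (e j)"]
    by (simp add: form_sum lessThan_atLeast0)
  moreover have "(\<Sum>i<j. \<omega> (e i) (e j)) = int j" using assms form_e by simp
  moreover have "(\<Sum>i = Suc j..<2 * g. \<omega> (e i) (e j)) = (\<Sum>i = Suc j..<2 * g. -1)"
    using form_e by (intro sum.cong) (auto simp: form_skew[of _ "e j"])
  ultimately show ?thesis using assms by simp
qed

lemma generates:
  "lie_generates QH0_scale (QH0_bracket \<omega>)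
     ((\<lambda>s. QH0_class (qh_basis s)) ` insert (- sum e {..<2 * g}) (e ` {..<2 * g}))"
  unfolding lie_generates_iff
proof (intro allI impI)
  fix L assume L: "lie_subalgebra QH0_scale (QH0_bracket \<omega>) L"
    and sub: "(\<lambda>s. QH0_class (qh_basis s)) ` insert (- sum e {..<2 * g}) (e ` {..<2 * g}) \<subseteq> L"
  define T where "T = {x. QH0_class (qh_basis x) \<in> L}"
  note T = lie_subalgebra_homogeneous[OF L, folded T_def]
  have e: "e i \<in> T" if "i < 2 * g" for i using sub that by (auto simp: T_def)
  have "- sum e {..<2 * g} \<in> T" using sub by (simp add: T_def)
  then have minus_e: "- e i \<in> T" if "i < 2 * g" for i
    using neg_interval_sum_mem[of T i "Suc i"] T(2) e that by simp
  note step = add_unit_mem[OF T(1,2) e minus_e]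
  \<comment> \<open>The translations preserving \<open>T\<close> form a subgroup; the equivalence,
    rather than one implication, gives closure under negation. As \<open>T\<close> contains 0, it is
    everything once all \<open>e i\<close> are such translations.\<close>
  have "{y. \<forall>x. x + y \<in> T \<longleftrightarrow> x \<in> T} = UNIV" (is "?G = _")
  proof (rule e_generates)
    show "0 \<in> ?G" by simp
    show "x + y \<in> ?G" if "x \<in> ?G" "y \<in> ?G" for x y
      using that by (simp flip: add.assoc)
    show "- y \<in> ?G" if "y \<in> ?G" for y
    proof -
      have "x + - y \<in> T \<longleftrightarrow> (x + - y) + y \<in> T" for x using that by blast
      then show ?thesis by simp
    qed
    show "e i \<in> ?G" if "i < 2 * g" for i
    proof -
      have "x \<in> T" if "x + e i \<in> T" for x
        using step[of "x + e i" i "- e i"] that \<open>i < 2 * g\<close> by simp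
      then show ?thesis using step[of _ i "e i"] that by blast
    qed
  qed
  then have "0 + y \<in> T" for y using T(1) by blast
  then show "L = UNIV" using T(3) by auto
qed

lemma primitive_e:
  assumes "i < 2 * g"
  shows "primitive (e i)"
proof (rule primitiveI)
  fix n :: int assume "2 \<le> n"
  \<comment> \<open>Any index other than \<open>i\<close> would do; its pairing with
    \<open>e i\<close> is 1 or -1.\<close>
  define j where "j = (if i = 0 then 1 else 0 :: nat)"
  have "j < 2 * g" "j \<noteq> i" using assms by (auto simp: j_def)
  then have "\<omega> (e i) (e j) = 1 \<or> \<omega> (e i) (e j) = -1"
    using form_e[of i j] form_e[of j i] form_skew[of "e i" "e j"] assms
    by (cases i j rule: linorder_cases) auto
  then have "\<not> n dvd \<omega> (e i) (e j)" using \<open>2 \<le> n\<close> by auto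
  then show "\<exists>y. \<not> n dvd \<omega> (e i) y" ..
qed

text \<open>The pairings with \<open>e 0\<close> and \<open>e 1\<close> are \<open>2 * g - 1\<close>
  and \<open>2 * g - 3\<close>, consecutive odd numbers and hence coprime.\<close>

lemma primitive_total:
  assumes "g \<ge> 1"
  shows "primitive (- sum e {..<2 * g})"
proof (rule primitiveI, rule ccontr)
  fix n :: int assume "2 \<le> n"
  assume "\<nexists>y. \<not> n dvd \<omega> (- sum e {..<2 * g}) y"
  then have "n dvd \<omega> (- sum e {..<2 * g}) (e 0)" "n dvd \<omega> (- sum e {..<2 * g}) (e 1)" by blast+
  then have "n dvd 2 * int g - 1" "n dvd 2 * int g - 3"
    using form_total[of 0] form_total[of 1] assms by (simp_all del: form_minus)
  then have "n dvd 2" using dvd_diff by fastforce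
  then have "n = 2" using \<open>2 \<le> n\<close> zdvd_imp_le by force
  then show False using \<open>n dvd 2 * int g - 1\<close> by presburger
qed

text \<open>Distinct indices pair to nonzero values while \<omega> x x is zero, so the
  \<open>e i\<close> are distinct. The last generator has odd pairing with each \<open>e j\<close>,
  so it equals none of them.\<close>

lemma card_generators: "card (insert (- sum e {..<2 * g}) (e ` {..<2 * g})) = 2 * g + 1"
proof -
  have "inj_on e {..<2 * g}"
    using form_e_nonzero form_self by (intro inj_onI) (metis lessThan_iff)
  moreover have "- sum e {..<2 * g} \<noteq> e j" if "j < 2 * g" for j
  proof
    assume "- sum e {..<2 * g} = e j"
    then have "2 * int g - 1 - 2 * int j = 0" using form_total[OF that] by simp
    then show False by presburger
  qed
  ultimately show ?thesis by (subst card_insert_disjoint) (auto simp: card_image)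
qed

end

section \<open>From a symplectic basis to one with unit pairings\<close>

context surface_intersection_form
begin

lemma unit_intersection_basis_exists: "\<exists>e. unit_intersection_basis g \<omega> e"
proof -
  obtain A B where AB: "symplectic_basis g \<omega> A B" using form_symplectic_basis by blast
  have AA: "\<omega> (A i) (A j) = 0" and BB: "\<omega> (B i) (B j) = 0"
    and A_B: "\<omega> (A i) (B j) = (if i = j then 1 else 0)"
    and B_A: "\<omega> (B i) (A j) = (if i = j then - 1 else 0)" if "i < g" "j < g" for i j
    using AB that form_skew[of "B i" "A j"] by (auto simp: symplectic_basis_def)
  \<comment> \<open>\<open>D k\<close> is a correction term: \<open>A l\<close> and
    \<open>B l\<close> pair to 1 with it when \<open>l < k\<close> and to 0 otherwise. Adding it to
    \<open>A k\<close> and \<open>B k\<close> creates the pairings with earlier blocks and keeps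
    \<omega> (A k) (B k) = 1 within the block.\<close>
  define D where "D k = (\<Sum>l<k. B l - A l)" for k
  define e where "e j = (if even j then A (j div 2) else B (j div 2)) + D (j div 2)" for j
  have A_D: "\<omega> (A l) (D k) = (if l < k then 1 else 0)" if "l < g" "k \<le> g" for l k
  proof -
    have "\<omega> (A l) (D k) = (\<Sum>m<k. if m = l then 1 else 0)"
      unfolding D_def form_sum using that by (intro sum.cong) (auto simp: form_diff A_B AA)
    then show ?thesis by simp
  qed
  have B_D: "\<omega> (B l) (D k) = (if l < k then 1 else 0)" if "l < g" "k \<le> g" for l k
  proof -
    have "\<omega> (B l) (D k) = (\<Sum>m<k. if m = l then 1 else 0)"
      unfolding D_def form_sum using that by (intro sum.cong) (auto simp: form_diff B_A BB)
    then show ?thesis by simp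
  qed
  have D_D: "\<omega> (D l) (D k) = 0" if "l \<le> k" "k \<le> g" for l k
  proof -
    have "\<omega> (D l) (D k) = (\<Sum>m<l. \<omega> (B m) (D k) - \<omega> (A m) (D k))"
      by (simp add: D_def[of l] form_sum form_diff)
    also have "\<dots> = 0" using that by (intro sum.neutral) (auto simp: A_D B_D)
    finally show ?thesis .
  qed
  have D_A: "\<omega> (D l) (A k) = 0" and D_B: "\<omega> (D l) (B k) = 0" if "l \<le> k" "k < g" for l k
    using that A_D[of k l] B_D[of k l] form_skew[of "D l"] by auto
  have "unit_intersection_basis g \<omega> e"
  proof unfold_locales
    fix i j assume "i < j" "j < 2 * g"
    then have lt: "i div 2 \<le> j div 2" "i div 2 < g" "j div 2 < g" by auto
    show "\<omega> (e i) (e j) = 1"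
    proof (cases "i div 2 = j div 2")
      case True
      then have "even i" "odd j" using \<open>i < j\<close> by presburger+
      then show ?thesis
        using True lt by (simp add: e_def form_add_left form_add_right A_B A_D D_B D_D)
    next
      case False
      then show ?thesis
        using lt by (simp add: e_def form_add_left form_add_right AA BB A_B B_A A_D B_D D_A D_B D_D)
    qed
  next
    fix X :: "'h set"
    assume X: "0 \<in> X" "\<And>x y. x \<in> X \<Longrightarrow> y \<in> X \<Longrightarrow> x + y \<in> X" "\<And>x. x \<in> X \<Longrightarrow> - x \<in> X"
      and eX: "\<And>i. i < 2 * g \<Longrightarrow> e i \<in> X"
    have diff: "x - y \<in> X" if "x \<in> X" "y \<in> X" for x y
      using X(2)[of x "- y"] X(3) that by simp
    \<comment> \<open>The differences within blocks give every \<open>D k\<close>, and subtracting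
      \<open>D k\<close> recovers \<open>A k\<close> and \<open>B k\<close>.\<close>
    have "e (2 * k + 1) - e (2 * k) = B k - A k" for k by (simp add: e_def)
    then have "B k - A k \<in> X" if "k < g" for k
      using diff[of "e (2 * k + 1)" "e (2 * k)"] eX that by simp
    then have DX: "D k \<in> X" if "k \<le> g" for k
      unfolding D_def using that X(1,2) by (induction k) auto
    have "A k = e (2 * k) - D k" "B k = e (2 * k + 1) - D k" for k by (simp_all add: e_def)
    then show "X = UNIV"
      using diff eX DX X by (intro subgroup_eq_UNIV[OF AB]) auto
  qed
  then show ?thesis by blast
qed

end

theorem mainTheorem2:
  fixes g :: nat and \<omega> :: "'h::ab_group_add \<Rightarrow> 'h \<Rightarrow> int"
  assumes "surface_intersection_form g \<omega>" and "g \<ge> 1"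
  shows "(\<exists>S :: 'h set. finite S \<and> card S = 2 * g + 1 \<and> (\<forall>s\<in>S. primitive s) \<and>
            lie_generates QH0_scale (QH0_bracket \<omega>) ((\<lambda>s. QH0_class (qh_basis s)) ` S)) \<and>
         (\<forall>S :: 'h set.
            lie_generates QH0_scale (QH0_bracket \<omega>) ((\<lambda>s. QH0_class (qh_basis s)) ` S) \<longrightarrow>
            infinite S \<or> card S \<ge> 2 * g + 1)"
proof -
  interpret surface_intersection_form g \<omega> by (rule assms(1))
  obtain e where "unit_intersection_basis g \<omega> e" using unit_intersection_basis_exists by blast
  then interpret unit_intersection_basis g \<omega> e .
  let ?S = "insert (- sum e {..<2 * g}) (e ` {..<2 * g})"
  show ?thesis
  proof (intro conjI exI[of _ ?S] allI impI)
    show "\<forall>s\<in>?S. primitive s"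
      using primitive_e primitive_total[OF assms(2)] by auto
    fix S :: "'h set"
    assume "lie_generates QH0_scale (QH0_bracket \<omega>) ((\<lambda>s. QH0_class (qh_basis s)) ` S)"
    then show "infinite S \<or> card S \<ge> 2 * g + 1"
      using card_ge_if_generates[OF assms(2)] by (cases "finite S") simp_all
  qed (rule card_generators generates | simp)+
qed

end
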